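(* Let $R$ be a ring with identity $1$, let $n\geq 1$ be an integer and let $C\subseteq R$ be a commutative submonoid of the multiplicative monoid of $R$. Then the subring $S=\langle \mathrm{Z}_n(R)\cup C\rangle$ of $R$ generated by the subset $\mathrm{Z}_n(R)\cup C\subseteq R$ has property $\mathrm{L}_n$, i.e. $[x_1,x_2,\ldots,x_n,x_{n+1}]_{n+1}^*=0$ for all $x_1,\ldots,x_{n+1}\in S$.
   Context: Rings are associative. For elements $x,y$ of a ring, $[x,y]=xy-yx$. Left normed commutators are defined by $[x_1]_1^*=x_1$ and $[x_1,\ldots,x_{k+1}]_{k+1}^*=[[x_1,\ldots,x_k]_k^*,x_{k+1}]$. The $n$-th Lie center of $R$ is $\mathrm{Z}_n(R)=\{r\in R\mid [r,x_1,\ldots,x_n]_{n+1}^*=0\text{ for all }x_1,\ldots,x_n\in R\}$. A submonoid of the multiplicative monoid of $R$ contains $1$. *)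

theory Defs
  imports "HOL-Algebra.Generated_Rings"
begin

definition lie_bracket :: "('a, 'b) ring_scheme \<Rightarrow> 'a \<Rightarrow> 'a \<Rightarrow> 'a"
  where "lie_bracket R x y = x \<otimes>\<^bsub>R\<^esub> y \<ominus>\<^bsub>R\<^esub> y \<otimes>\<^bsub>R\<^esub> x"

text \<open>
  The list \<open>[x\<^sub>1, \<dots>, x\<^sub>k]\<close> encodes the arguments of the left normed commutator of length
  \<open>k \<ge> 1\<close>, bracketed as \<open>[\<dots>[[x\<^sub>1, x\<^sub>2], x\<^sub>3], \<dots>, x\<^sub>k]\<close>; the two lemmas
  give the usual recursion.  The value on the empty list is irrelevant.
\<close>

definition left_normed :: "('a, 'b) ring_scheme \<Rightarrow> 'a list \<Rightarrow> 'a"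
  where "left_normed R xs = foldl (lie_bracket R) (hd xs) (tl xs)"

lemma left_normed_singleton: "left_normed R [x] = x"
  by (simp add: left_normed_def)

lemma left_normed_snoc:
  "xs \<noteq> [] \<Longrightarrow> left_normed R (xs @ [y]) = lie_bracket R (left_normed R xs) y"
  by (simp add: left_normed_def)

definition lie_center :: "('a, 'b) ring_scheme \<Rightarrow> nat \<Rightarrow> 'a set"
  where "lie_center R n =
    {r \<in> carrier R. \<forall>xs. length xs = n \<and> set xs \<subseteq> carrier R \<longrightarrow> left_normed R (r # xs) = \<zero>\<^bsub>R\<^esub>}"

text \<open>
  Property \<open>L\<^sub>n\<close> of a subring \<open>S\<close> of \<open>R\<close>; since \<open>S\<close> inherits its operations,
  the commutators are computed in \<open>R\<close>.
\<close>

definition property_L :: "('a, 'b) ring_scheme \<Rightarrow> nat \<Rightarrow> 'a set \<Rightarrow> bool"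
  where "property_L R n S \<longleftrightarrow>
    (\<forall>xs. length xs = n + 1 \<and> set xs \<subseteq> S \<longrightarrow> left_normed R xs = \<zero>\<^bsub>R\<^esub>)"

end

theory Submission
  imports Defs
begin

text \<open>
  The cyclic identity \<open>[ab, c] = [a, bc] + [b, ca]\<close> shows that every Lie center is a subring
  and reduces the claim to \<open>[c, s] \<in> Z\<^sub>n\<^sub>-\<^sub>1\<close> for \<open>c \<in> C\<close> and \<open>s \<in> S\<close>.  Since
  \<open>[Z\<^sub>n, R] \<subseteq> Z\<^sub>n\<close>, the ring \<open>S\<close> is additively spanned by the products \<open>uz\<close> with
  \<open>u \<in> C\<close>, \<open>z \<in> Z\<^sub>n\<close>, and \<open>[c, uz] = u[c, z]\<close>.  So everything rests on the fact that
  \<open>u[z, c] \<in> Z\<^sub>n\<^sub>-\<^sub>1\<close> whenever \<open>z \<in> Z\<^sub>n\<close> and \<open>u\<close>, \<open>c\<close> commute, which is proved by induction on \<open>n\<close>.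
\<close>

context ring
begin

section \<open>Identities for the Lie bracket\<close>

lemma lie_bracket_closed [simp, intro]:
  "\<lbrakk>x \<in> carrier R; y \<in> carrier R\<rbrakk> \<Longrightarrow> lie_bracket R x y \<in> carrier R"
  by (simp add: lie_bracket_def)

lemma lie_bracket_cyclic:
  assumes "a \<in> carrier R" "b \<in> carrier R" "c \<in> carrier R"
  shows "lie_bracket R (a \<otimes> b) c = lie_bracket R a (b \<otimes> c) \<oplus> lie_bracket R b (c \<otimes> a)"
  using assms unfolding lie_bracket_def by algebra

lemma lie_bracket_add_left:
  assumes "a \<in> carrier R" "b \<in> carrier R" "c \<in> carrier R"
  shows "lie_bracket R (a \<oplus> b) c = lie_bracket R a c \<oplus> lie_bracket R b c"
  using assms unfolding lie_bracket_def by algebra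

lemma lie_bracket_add_right:
  assumes "a \<in> carrier R" "b \<in> carrier R" "c \<in> carrier R"
  shows "lie_bracket R a (b \<oplus> c) = lie_bracket R a b \<oplus> lie_bracket R a c"
  using assms unfolding lie_bracket_def by algebra

lemma lie_bracket_minus_left:
  assumes "a \<in> carrier R" "b \<in> carrier R"
  shows "lie_bracket R (\<ominus> a) b = \<ominus> lie_bracket R a b"
  using assms unfolding lie_bracket_def by algebra

lemma lie_bracket_zero_left: "a \<in> carrier R \<Longrightarrow> lie_bracket R \<zero> a = \<zero>"
  unfolding lie_bracket_def by algebra

lemma lie_bracket_one_left: "a \<in> carrier R \<Longrightarrow> lie_bracket R \<one> a = \<zero>"
  by (simp add: lie_bracket_def minus_eq r_neg)

section \<open>The Lie centers: recursion and closure properties\<close>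

lemma lie_center_0: "lie_center R 0 = {\<zero>}"
  by (auto simp: lie_center_def left_normed_def)

text \<open>The innermost bracket of a left normed commutator joins its first two entries, so the
  first argument can be absorbed into the head. The inductions on \<open>n\<close> below run on this
  recursion.\<close>

lemma lie_center_Suc:
  "lie_center R (Suc n) = {r \<in> carrier R. \<forall>x\<in>carrier R. lie_bracket R r x \<in> lie_center R n}"
proof -
  have "left_normed R (r # x # ys) = left_normed R (lie_bracket R r x # ys)" for r x ys
    by (simp add: left_normed_def)
  then have *: "(\<forall>xs. length xs = Suc n \<and> set xs \<subseteq> carrier R \<longrightarrow> left_normed R (r # xs) = \<zero>) \<longleftrightarrow>
      (\<forall>x\<in>carrier R. \<forall>ys. length ys = n \<and> set ys \<subseteq> carrier R \<longrightarrow>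
        left_normed R (lie_bracket R r x # ys) = \<zero>)" for r
    by (simp add: length_Suc_conv) (metis insert_subset list.simps(15))
  show ?thesis
    unfolding lie_center_def * by auto
qed

lemma lie_center_carrier: "lie_center R n \<subseteq> carrier R"
  by (auto simp: lie_center_def)

lemma lie_center_closed: "x \<in> lie_center R n \<Longrightarrow> x \<in> carrier R"
  using lie_center_carrier by blast

lemma lie_bracket_lie_center:
  "\<lbrakk>z \<in> lie_center R (Suc n); x \<in> carrier R\<rbrakk> \<Longrightarrow> lie_bracket R z x \<in> lie_center R n"
  by (simp add: lie_center_Suc)

lemma lie_center_zero: "\<zero> \<in> lie_center R n"
  by (induction n) (simp_all add: lie_center_0 lie_center_Suc lie_bracket_zero_left)

lemma lie_center_one: "\<one> \<in> lie_center R (Suc n)"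
  by (simp add: lie_center_Suc lie_bracket_one_left lie_center_zero)

lemma lie_center_add:
  "\<lbrakk>x \<in> lie_center R n; y \<in> lie_center R n\<rbrakk> \<Longrightarrow> x \<oplus> y \<in> lie_center R n"
  by (induction n arbitrary: x y)
     (simp_all add: lie_center_0 lie_center_Suc lie_bracket_add_left)

lemma lie_center_minus: "x \<in> lie_center R n \<Longrightarrow> \<ominus> x \<in> lie_center R n"
  by (induction n arbitrary: x)
     (simp_all add: lie_center_0 lie_center_Suc lie_bracket_minus_left)

text \<open>Each summand of the cyclic identity has \<open>x\<close> or \<open>y\<close> alone as
  its left entry, and that already places it in the center one level down.\<close>

lemma lie_center_mult:
  assumes "x \<in> lie_center R n" "y \<in> lie_center R n"
  shows "x \<otimes> y \<in> lie_center R n"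
proof (cases n)
  case 0
  with assms show ?thesis by (simp add: lie_center_0)
next
  case (Suc m)
  have R: "x \<in> carrier R" "y \<in> carrier R" using assms lie_center_closed by blast+
  have "lie_bracket R (x \<otimes> y) r \<in> lie_center R m" if "r \<in> carrier R" for r
    unfolding lie_bracket_cyclic[OF R that]
    using assms R that unfolding Suc by (intro lie_center_add lie_bracket_lie_center) auto
  with R show ?thesis by (simp add: Suc lie_center_Suc)
qed

lemma lie_center_mono: "x \<in> lie_center R n \<Longrightarrow> x \<in> lie_center R (Suc n)"
proof (induction n arbitrary: x)
  case 0
  then show ?case by (simp add: lie_center_0 lie_center_zero)
next
  case (Suc n)
  then show ?case by (subst lie_center_Suc) (simp add: lie_center_Suc[of n])
qed

section \<open>Multiplying a bracket by a commuting element\<close>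

lemma lie_bracket_swap:
  assumes "x \<in> carrier R" "y \<in> carrier R"
  shows "lie_bracket R x y = \<ominus> lie_bracket R y x"
  using assms unfolding lie_bracket_def by algebra

text \<open>With \<open>w = [z, c]\<close>, the cyclic identity gives
  \<open>[uw, r] = [u, wr] + [w, ru]\<close>, where the last term is harmless. The term
  \<open>[u, wr]\<close> is found by bracketing the Leibniz expansion of \<open>[z, cr]\<close> with
  \<open>u\<close>.\<close>

lemma commuting_mult_lie_bracket:
  assumes "z \<in> lie_center R (Suc n)" "u \<in> carrier R" "c \<in> carrier R" "u \<otimes> c = c \<otimes> u"
  shows "u \<otimes> lie_bracket R z c \<in> lie_center R n"
  using assms
proof (induction n arbitrary: z u c)
  case 0
  then have "lie_bracket R z c = \<zero>"
    using lie_bracket_lie_center lie_center_0 by blast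
  with 0 show ?case by (simp add: lie_center_0)
next
  case (Suc n)
  define w where "w = lie_bracket R z c"
  have z: "z \<in> carrier R" using Suc.prems(1) by (rule lie_center_closed)
  have w: "w \<in> lie_center R (Suc n)"
    unfolding w_def by (intro lie_bracket_lie_center Suc.prems)
  then have wR: "w \<in> carrier R" by (rule lie_center_closed)
  have "lie_bracket R (u \<otimes> w) r \<in> lie_center R n" if r: "r \<in> carrier R" for r
  proof -
    have zcr: "lie_bracket R (lie_bracket R z (c \<otimes> r)) u \<in> lie_center R n"
      using Suc.prems r by (intro lie_bracket_lie_center) auto
    \<comment> \<open>The induction hypothesis is applied to \<open>[z, r]\<close> with the roles of
      \<open>u\<close> and \<open>c\<close> exchanged.\<close>
    have zr: "c \<otimes> lie_bracket R (lie_bracket R z r) u \<in> lie_center R n"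
      using Suc.prems r by (intro Suc.IH lie_bracket_lie_center) auto
    have "lie_bracket R z (c \<otimes> r) = c \<otimes> lie_bracket R z r \<oplus> w \<otimes> r"
      using z r Suc.prems(2,3) unfolding w_def lie_bracket_def by algebra
    \<comment> \<open>Since \<open>u\<close> and \<open>c\<close> commute, \<open>c\<close> can be
      pulled out of a bracket with \<open>u\<close>.\<close>
    moreover have "lie_bracket R (c \<otimes> q) u = c \<otimes> lie_bracket R q u" if "q \<in> carrier R" for q
    proof -
      have "u \<otimes> (c \<otimes> q) = c \<otimes> (u \<otimes> q)"
        using Suc.prems that by (metis m_assoc)
      with Suc.prems that show ?thesis
        unfolding lie_bracket_def by (simp add: m_assoc minus_eq r_distr r_minus)
    qed
    ultimately have "lie_bracket R (lie_bracket R z (c \<otimes> r)) u =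
        c \<otimes> lie_bracket R (lie_bracket R z r) u \<oplus> lie_bracket R (w \<otimes> r) u"
      using z r wR Suc.prems(2,3) by (simp add: lie_bracket_add_left)
    then have "lie_bracket R u (w \<otimes> r) =
        c \<otimes> lie_bracket R (lie_bracket R z r) u \<oplus>
        \<ominus> lie_bracket R (lie_bracket R z (c \<otimes> r)) u"
      using z r wR Suc.prems(2,3)
      by (simp add: lie_bracket_swap[of u] minus_add r_neg2)
    then have "lie_bracket R u (w \<otimes> r) \<in> lie_center R n"
      using zcr zr by (simp add: lie_center_add lie_center_minus)
    moreover have "lie_bracket R w (r \<otimes> u) \<in> lie_center R n"
      using w r Suc.prems(2) by (intro lie_bracket_lie_center) auto
    ultimately show ?thesis
      using r wR Suc.prems(2) by (simp add: lie_bracket_cyclic lie_center_add)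
  qed
  then have "u \<otimes> w \<in> lie_center R (Suc n)"
    using Suc.prems(2) wR by (subst lie_center_Suc) simp
  then show ?case unfolding w_def .
qed

end

section \<open>The additive span of products, and brackets in the generated ring\<close>

inductive_set product_span :: "('a, 'b) ring_scheme \<Rightarrow> 'a set \<Rightarrow> 'a set \<Rightarrow> 'a set"
  for R and A and B where
    product: "\<lbrakk>a \<in> A; b \<in> B\<rbrakk> \<Longrightarrow> a \<otimes>\<^bsub>R\<^esub> b \<in> product_span R A B"
  | sum: "\<lbrakk>x \<in> product_span R A B; y \<in> product_span R A B\<rbrakk> \<Longrightarrow> x \<oplus>\<^bsub>R\<^esub> y \<in> product_span R A B"

context ring
begin

lemma product_span_closed:
  assumes "A \<subseteq> carrier R" "B \<subseteq> carrier R" "x \<in> product_span R A B"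
  shows "x \<in> carrier R"
  using assms(3) by induction (use assms(1,2) in auto)

text \<open>The span is stable under left multiplication by both kinds of generators, hence by all
  of the generated ring. As it contains \<open>1\<close>, it contains \<open>s = s1\<close>.\<close>

lemma generate_ring_lie_center_product_span:
  assumes C: "submonoid C R" and s: "s \<in> generate_ring R (lie_center R (Suc n) \<union> C)"
  shows "s \<in> product_span R C (lie_center R (Suc n))"
proof -
  let ?Z = "lie_center R (Suc n)"
  let ?Q = "product_span R C ?Z"
  have CR: "C \<subseteq> carrier R" using C by (rule submonoid.subset)
  have QR: "x \<in> carrier R" if "x \<in> ?Q" for x
    using CR lie_center_carrier that by (rule product_span_closed)
  have SR: "x \<in> carrier R" if "x \<in> generate_ring R (?Z \<union> C)" for x
    using generate_ring_in_carrier[OF _ that] CR lie_center_carrier by blast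
  \<comment> \<open>A sign is absorbed by the central factor, so closure under sums makes the span
    an additive group.\<close>
  have minus: "\<ominus> x \<in> ?Q" if "x \<in> ?Q" for x
    using that
  proof induction
    case (product c z)
    then have "\<ominus> (c \<otimes> z) = c \<otimes> (\<ominus> z)"
      using CR lie_center_closed by (metis r_minus subsetD)
    then show ?case using product by (simp add: lie_center_minus product_span.product)
  next
    case (sum x y)
    then show ?case by (simp add: QR minus_add product_span.sum)
  qed
  have mult_C: "c \<otimes> x \<in> ?Q" if "x \<in> ?Q" "c \<in> C" for x c
    using that(1)
  proof induction
    case (product d z)
    then have "c \<otimes> (d \<otimes> z) = (c \<otimes> d) \<otimes> z"
      using CR lie_center_closed that(2) by (metis m_assoc subsetD)
    then show ?case
      using product that(2) C by (simp add: submonoid.m_closed product_span.product)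
  next
    case (sum x y)
    moreover have "c \<in> carrier R" using CR that(2) by blast
    ultimately show ?case by (simp add: QR r_distr product_span.sum)
  qed
  have mult_Z: "y \<otimes> x \<in> ?Q" if "x \<in> ?Q" "y \<in> ?Z" for x y
    using that(1)
  proof induction
    case (product c z)
    have R: "c \<in> carrier R" "z \<in> carrier R" "y \<in> carrier R"
      using product that(2) CR lie_center_closed by blast+
    \<comment> \<open>Moving \<open>y\<close> past \<open>c\<close> costs the commutator
      \<open>[y, c]\<close>, which lies in \<open>?Z\<close> again. The factor \<open>1\<close>, an
      element of \<open>C\<close>, gives the correction term the shape of a spanning
      product.\<close>
    then have "y \<otimes> (c \<otimes> z) = c \<otimes> (y \<otimes> z) \<oplus> \<one> \<otimes> (lie_bracket R y c \<otimes> z)"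
      unfolding lie_bracket_def by algebra
    moreover have "lie_bracket R y c \<in> ?Z"
      by (rule lie_center_mono[OF lie_bracket_lie_center[OF that(2) R(1)]])
    ultimately show ?case
      using product that(2) submonoid.one_closed[OF C]
      by (metis lie_center_mult product_span.intros)
  next
    case (sum x x')
    moreover have "y \<in> carrier R" using that(2) by (rule lie_center_closed)
    ultimately show ?case by (simp add: QR r_distr product_span.sum)
  qed
  \<comment> \<open>Keeping \<open>q\<close> arbitrary lets the product case apply one factor after
    the other.\<close>
  have "s \<otimes> q \<in> ?Q" if "q \<in> ?Q" for q
    using s that
  proof (induction arbitrary: q)
    case one
    then show ?case by (simp add: QR)
  next
    case (incl h)
    then show ?case using mult_C mult_Z by blast
  next
    case (a_inv h)
    then show ?case by (simp add: l_minus minus QR SR)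
  next
    case (eng_add h h')
    then show ?case by (simp add: l_distr product_span.sum QR SR)
  next
    case (eng_mult h h')
    then show ?case by (simp add: m_assoc QR SR)
  qed
  moreover have "\<one> \<otimes> \<one> \<in> ?Q"
    using submonoid.one_closed[OF C] lie_center_one by (rule product_span.product)
  ultimately show ?thesis using SR[OF s] by (metis l_one one_closed r_one)
qed

text \<open>Induction on the construction of \<open>x\<close> reduces to generators: for
  \<open>x\<close> in the center the claim is immediate, and for \<open>x\<close> in
  \<open>C\<close> the second entry is expanded into products.\<close>

lemma lie_bracket_generate_ring_lie_center:
  assumes C: "submonoid C R"
    and comm: "\<And>x y. \<lbrakk>x \<in> C; y \<in> C\<rbrakk> \<Longrightarrow> x \<otimes> y = y \<otimes> x"
    and x: "x \<in> generate_ring R (lie_center R (Suc n) \<union> C)"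
    and y: "y \<in> generate_ring R (lie_center R (Suc n) \<union> C)"
  shows "lie_bracket R x y \<in> lie_center R n"
proof -
  let ?S = "generate_ring R (lie_center R (Suc n) \<union> C)"
  have CR: "C \<subseteq> carrier R" using C by (rule submonoid.subset)
  have SR: "x \<in> carrier R" if "x \<in> ?S" for x
    using generate_ring_in_carrier[OF _ that] CR lie_center_carrier by blast
  have C_bracket: "lie_bracket R c s \<in> lie_center R n"
    if c: "c \<in> C" and s: "s \<in> product_span R C (lie_center R (Suc n))" for c s
    using s
  proof induction
    case (product u z)
    have R: "c \<in> carrier R" "u \<in> carrier R" "z \<in> carrier R"
      using c product CR lie_center_closed by blast+
    \<comment> \<open>Commutativity of \<open>C\<close> enters here: \<open>u\<close> comes out on
      the left of the bracket, in the form handled by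
      \<open>commuting_mult_lie_bracket\<close>.\<close>
    have "c \<otimes> (u \<otimes> z) = u \<otimes> (c \<otimes> z)"
      using R comm[OF c product(1)] by (metis m_assoc)
    then have "lie_bracket R c (u \<otimes> z) = \<ominus> (u \<otimes> lie_bracket R z c)"
      using R unfolding lie_bracket_def
      by (simp add: m_assoc minus_eq r_distr r_minus minus_add a_comm)
    then show ?case
      using commuting_mult_lie_bracket[OF product(2) R(2,1)] comm[OF product(1) c]
      by (simp add: lie_center_minus)
  next
    case (sum s t)
    have "s \<in> carrier R" "t \<in> carrier R"
      using sum product_span_closed[OF CR lie_center_carrier] by blast+
    moreover have "c \<in> carrier R" using c CR by blast
    ultimately show ?case using sum by (simp add: lie_bracket_add_right lie_center_add)
  qed
  show ?thesis
    using x y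
  \<comment> \<open>The product case brackets \<open>h\<close> with \<open>h'y\<close> and
    \<open>h'\<close> with \<open>yh\<close>, so \<open>y\<close> must range over the whole
    generated ring.\<close>
  proof (induction arbitrary: y)
    case one
    then show ?case by (simp add: SR lie_bracket_one_left lie_center_zero)
  next
    case (incl h)
    then show ?case
      using C_bracket generate_ring_lie_center_product_span[OF C] SR lie_bracket_lie_center
      by blast
  next
    case (a_inv h)
    then show ?case by (simp add: SR lie_bracket_minus_left lie_center_minus)
  next
    case (eng_add h h')
    then show ?case by (simp add: SR lie_bracket_add_left lie_center_add)
  next
    case (eng_mult h h')
    then show ?case
      by (simp add: SR lie_bracket_cyclic lie_center_add generate_ring.eng_mult)
  qed
qed

end

theorem theorem4p1:
  fixes R :: "('a, 'b) ring_scheme" and n :: nat and C :: "'a set"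
  assumes "ring R"
    and "n \<ge> 1"
    and "submonoid C R"
    and "\<forall>x\<in>C. \<forall>y\<in>C. x \<otimes>\<^bsub>R\<^esub> y = y \<otimes>\<^bsub>R\<^esub> x"
  shows "property_L R n (generate_ring R (lie_center R n \<union> C))"
proof -
  interpret ring R by fact
  obtain m where n: "n = Suc m" using assms(2) by (cases n) auto
  let ?S = "generate_ring R (lie_center R n \<union> C)"
  have SR: "?S \<subseteq> carrier R"
    using lie_center_carrier submonoid.subset[OF assms(3)] by (intro generate_ring_incl) blast
  have "left_normed R xs = \<zero>\<^bsub>R\<^esub>" if xs: "length xs = n + 1" "set xs \<subseteq> ?S" for xs
  proof -
    \<comment> \<open>There are \<open>n + 1 = m + 2\<close> entries: the first two form a bracket
      in the \<open>m\<close>-th center, and the remaining \<open>m\<close> annihilate it.\<close>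
    obtain x y ys where eq: "xs = x # y # ys" and len: "length ys = m"
      using xs(1) n by (auto simp: length_Suc_conv)
    have "lie_bracket R x y \<in> lie_center R m"
      using xs(2) assms(4) unfolding eq n
      by (intro lie_bracket_generate_ring_lie_center[OF assms(3)]) auto
    moreover have "set ys \<subseteq> carrier R" using xs(2) SR eq by auto
    ultimately have "left_normed R (lie_bracket R x y # ys) = \<zero>\<^bsub>R\<^esub>"
      using len by (simp add: lie_center_def)
    then show ?thesis by (simp add: eq left_normed_def)
  qed
  then show ?thesis by (simp add: property_L_def)
qed

end
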